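(* For every $n\ge 1$, $P_{\mathrm{DASASM}}=P_{\mathrm{ASM}}\cap P_{\mathrm{DAS}}$.
   Context: $[n]=\{1,\dots,n\}$. An $n\times n$ alternating sign matrix (ASM) is an $n\times n$ matrix with entries in $\{0,1,-1\}$ such that in each row and each column the non-zero entries alternate in sign and the first and last non-zero entries are $1$ (so every row and column sums to $1$). $P_{\mathrm{ASM}}\subseteq\mathbb R^{n\times n}$ is the convex hull of all $n\times n$ ASMs. $P_{\mathrm{DAS}}=\{X\in\mathbb R^{n\times n}: x_{i,j}=x_{j,i}=x_{n+1-j,n+1-i}\ \forall i,j\in[n]\}$. A DASASM (diagonally and antidiagonally symmetric ASM) is an $n\times n$ ASM lying in $P_{\mathrm{DAS}}$, and $P_{\mathrm{DASASM}}\subseteq\mathbb R^{n\times n}$ is the convex hull of all $n\times n$ DASASMs. *)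

theory Defs
  imports "HOL-Analysis.Analysis"
begin

type_synonym 'n square_matrix = "((real, 'n) vec, 'n) vec"

(* Matrices in R^(n x n) have type real^'n^'n with n = CARD('n).  The index type is
   linearly ordered, and index k is its k-th smallest element, so that [n] = {1..CARD('n)}
   is identified with 'n in increasing order.  Numbers k outside [n] are never used. *)
definition index :: "nat \<Rightarrow> 'n::{finite,linorder}" where
  "index k = sorted_list_of_set UNIV ! (k - 1)"

lemma strict_mono_on_index:
  "strict_mono_on {1..CARD('n)} (index :: nat \<Rightarrow> 'n::{finite,linorder})"
  unfolding index_def
  by (intro strict_mono_onI sorted_wrt_nth_less[OF strict_sorted_list_of_set]) auto

lemma bij_betw_index: "bij_betw (index :: nat \<Rightarrow> 'n::{finite,linorder}) {1..CARD('n)} UNIV"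
proof -
  have "inj_on (index :: nat \<Rightarrow> 'n) {1..CARD('n)}"
    by (rule strict_mono_on_imp_inj_on[OF strict_mono_on_index])
  moreover from this have "index ` {1..CARD('n)} = (UNIV :: 'n set)"
    by (intro card_subset_eq) (auto simp: card_image)
  ultimately show ?thesis by (simp add: bij_betw_def)
qed

definition entry :: "'n::{finite,linorder} square_matrix \<Rightarrow> nat \<Rightarrow> nat \<Rightarrow> real" where
  "entry X i j = X $ index i $ index j"

definition nonzero_entries :: "nat \<Rightarrow> (nat \<Rightarrow> real) \<Rightarrow> real list" where
  "nonzero_entries n v = filter (\<lambda>x. x \<noteq> 0) (map v [1..<Suc n])"

(* The first and the last nonzero entry are required to exist: a zero line is excluded. *)
definition alternating_line :: "nat \<Rightarrow> (nat \<Rightarrow> real) \<Rightarrow> bool" where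
  "alternating_line n v \<longleftrightarrow>
     (let xs = nonzero_entries n v in
        xs \<noteq> [] \<and> hd xs = 1 \<and> last xs = 1 \<and> successively (\<lambda>x y. sgn x = - sgn y) xs)"

definition is_ASM :: "'n::{finite,linorder} square_matrix \<Rightarrow> bool" where
  "is_ASM X \<longleftrightarrow>
     (\<forall>i\<in>{1..CARD('n)}. \<forall>j\<in>{1..CARD('n)}. entry X i j \<in> {0, 1, -1}) \<and>
     (\<forall>i\<in>{1..CARD('n)}. alternating_line CARD('n) (\<lambda>j. entry X i j)) \<and>
     (\<forall>j\<in>{1..CARD('n)}. alternating_line CARD('n) (\<lambda>i. entry X i j))"

definition P_ASM :: "('n::{finite,linorder} square_matrix) set" where
  "P_ASM = convex hull {X. is_ASM X}"

definition P_DAS :: "('n::{finite,linorder} square_matrix) set" where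
  "P_DAS = {X. \<forall>i\<in>{1..CARD('n)}. \<forall>j\<in>{1..CARD('n)}.
     entry X i j = entry X j i \<and>
     entry X j i = entry X (CARD('n) + 1 - j) (CARD('n) + 1 - i)}"

definition is_DASASM :: "'n::{finite,linorder} square_matrix \<Rightarrow> bool" where
  "is_DASASM X \<longleftrightarrow> is_ASM X \<and> X \<in> P_DAS"

definition P_DASASM :: "('n::{finite,linorder} square_matrix) set" where
  "P_DASASM = convex hull {X. is_DASASM X}"

end

(* A matrix is encoded by its corner sums c(i,j), the sum of the entries in rows up to i and
   columns up to j.  Both the ASM inequalities (partial line sums between 0 and 1) and the two
   symmetries, c(i,j) = c(j,i) and c(i,j) = c(n-j,n-i) + i + j - n, are constraints on differences
   of corner sums with integer bounds.  Hence they are preserved when every c(i,j) is replaced by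
   the floor of c(i,j) + t, for any real t, and this rounding is the corner sum matrix of a
   DASASM.  Since the mean of the floor of c + t over t in [0,1] is c, the given matrix is a mean of
   DASASMs, so no hyperplane can separate it from their convex hull. *)
theory Submission
  imports Defs
begin

section \<open>Means over a real shift, and means as points of a convex hull\<close>

lemma has_integral_floor_shift: "((\<lambda>t. of_int \<lfloor>x + t\<rfloor>) has_integral x) {0..1::real}"
proof -
  define m where "m = real_of_int \<lfloor>x\<rfloor>"
  \<comment> \<open>The shift at which \<open>x + t\<close> reaches the next integer
    \<open>m + 1\<close>: the floor is \<open>m\<close> on a length of \<open>s\<close> and
    \<open>m + 1\<close> on a length of \<open>1 - s\<close>.\<close>
  define s where "s = 1 - frac x"
  have s: "0 \<le> s" "s \<le> 1"
    using frac_lt_1[of x] frac_ge_0[of x] by (simp_all add: s_def)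
  have x: "x = m + (1 - s)"
    by (simp add: m_def s_def frac_def)
  have "((\<lambda>t. m) has_integral m * s) {0..s}"
    using has_integral_const_real[of m 0 s] s by (simp add: mult.commute)
  then have "((\<lambda>t. of_int \<lfloor>x + t\<rfloor>) has_integral m * s) {0..s}"
  \<comment> \<open>At \<open>t = s\<close> the floor has already jumped to \<open>m + 1\<close>, so
    this endpoint is discarded as a null set.\<close>
  proof (rule has_integral_spike_finite[rotated 2])
    fix t assume "t \<in> {0..s} - {s}"
    then have "m \<le> x + t" "x + t < m + 1"
      using s x by auto
    then have "\<lfloor>x + t\<rfloor> = \<lfloor>x\<rfloor>"
      by (intro floor_unique) (simp_all add: m_def)
    then show "of_int \<lfloor>x + t\<rfloor> = m"
      by (simp add: m_def)
  qed simp
  moreover have "((\<lambda>t. m + 1) has_integral (m + 1) * (1 - s)) {s..1}"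
    using has_integral_const_real[of "m + 1" s 1] s by (simp add: mult.commute)
  then have "((\<lambda>t. of_int \<lfloor>x + t\<rfloor>) has_integral (m + 1) * (1 - s)) {s..1}"
  proof (rule has_integral_spike_finite[rotated 2])
    fix t assume "t \<in> {s..1} - {1}"
    then have "m + 1 \<le> x + t" "x + t < m + 2"
      using s x by auto
    then have "\<lfloor>x + t\<rfloor> = \<lfloor>x\<rfloor> + 1"
      by (intro floor_unique) (simp_all add: m_def)
    then show "of_int \<lfloor>x + t\<rfloor> = m + 1"
      by (simp add: m_def)
  qed simp
  ultimately have "((\<lambda>t. of_int \<lfloor>x + t\<rfloor>) has_integral m * s + (m + 1) * (1 - s)) {0..1}"
    by (rule has_integral_combine[OF s])
  moreover have "m * s + (m + 1) * (1 - s) = x"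
    unfolding x by (simp add: algebra_simps)
  ultimately show ?thesis
    by simp
qed

text \<open>Finiteness makes the hull compact, hence closed, so a point outside it is strictly
  separated by a hyperplane. Integration preserves only the weak inequality, but this already
  contradicts the strict bound at \<open>x\<close>.\<close>

lemma has_integral_in_convex_hull:
  fixes f :: "real \<Rightarrow> 'a::euclidean_space"
  assumes "finite S" "\<And>t. f t \<in> S" "(f has_integral x) {0..1}"
  shows "x \<in> convex hull S"
proof (rule ccontr)
  assume "x \<notin> convex hull S"
  moreover have "closed (convex hull S)"
    using assms(1) by (simp add: compact_imp_closed finite_imp_compact_convex_hull)
  ultimately obtain a b where ab: "a \<bullet> x < b" "\<And>y. y \<in> convex hull S \<Longrightarrow> b < a \<bullet> y"
    using separating_hyperplane_closed_point[OF convex_convex_hull] by metis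
  have "((\<lambda>t::real. b) has_integral b) {0..1}"
    using has_integral_const_real[of b 0 1] by simp
  moreover have "((\<lambda>t. a \<bullet> f t) has_integral a \<bullet> x) {0..1}"
    using has_integral_linear[OF assms(3) bounded_linear_inner_right[of a]] by (simp add: o_def)
  moreover have "b \<le> a \<bullet> f t" for t
    using ab(2)[OF hull_inc[OF assms(2)]] by (simp add: less_imp_le)
  ultimately have "b \<le> a \<bullet> x"
    by (rule has_integral_le)
  with ab(1) show False
    by simp
qed

lemma has_integral_matrixI:
  fixes f :: "real \<Rightarrow> real^'n^'m"
  assumes "\<And>i j. ((\<lambda>t. f t $ i $ j) has_integral x $ i $ j) S"
  shows "(f has_integral x) S"
  by (subst has_integral_componentwise_iff)
     (use assms in \<open>auto simp: Basis_vec_def inner_axis\<close>)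

section \<open>Alternating lines in terms of partial sums\<close>

lemma nonzero_entries_0 [simp]: "nonzero_entries 0 v = []"
  by (simp add: nonzero_entries_def)

lemma nonzero_entries_Suc:
  "nonzero_entries (Suc n) v =
     (if v (Suc n) = 0 then nonzero_entries n v else nonzero_entries n v @ [v (Suc n)])"
  by (simp add: nonzero_entries_def)

text \<open>Unlike \<open>alternating_line\<close>, \<open>alt\<close> does not ask for a nonzero
  entry or for a last one equal to 1, so it passes to prefixes and suits induction on
  \<open>n\<close>. The second conjunct strengthens the induction: the last nonzero entry, if any,
  determines the current sum, and thereby the values that the next entry may take.\<close>

lemma partial_sums_iff_alternating:
  fixes v :: "nat \<Rightarrow> real"
  defines "alt \<equiv> (\<lambda>n. (\<forall>i\<in>{1..n}. v i \<in> {0, 1, -1}) \<and>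
     (nonzero_entries n v = [] \<or> hd (nonzero_entries n v) = 1) \<and>
     successively (\<lambda>x y. sgn x = - sgn y) (nonzero_entries n v))"
  shows "((\<forall>k\<le>n. sum v {1..k} \<in> {0, 1}) \<longleftrightarrow> alt n) \<and>
    (alt n \<longrightarrow>
       (nonzero_entries n v = [] \<and> sum v {1..n} = 0 \<or>
        nonzero_entries n v \<noteq> [] \<and> last (nonzero_entries n v) = 1 \<and> sum v {1..n} = 1 \<or>
        nonzero_entries n v \<noteq> [] \<and> last (nonzero_entries n v) = -1 \<and> sum v {1..n} = 0))"
proof (induction n)
  case 0
  then show ?case by (simp add: alt_def)
next
  case (Suc n)
  have entries_Suc: "(\<forall>i\<in>{1..Suc n}. v i \<in> {0, 1, -1}) \<longleftrightarrow>
      (\<forall>i\<in>{1..n}. v i \<in> {0, 1, -1}) \<and> v (Suc n) \<in> {0, 1, -1}"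
    by (auto simp: le_Suc_eq)
  have alt_Suc: "alt (Suc n) \<longleftrightarrow> alt n \<and> (v (Suc n) = 0 \<or>
      v (Suc n) = 1 \<and> (nonzero_entries n v = [] \<or> last (nonzero_entries n v) < 0) \<or>
      v (Suc n) = -1 \<and> nonzero_entries n v \<noteq> [] \<and> last (nonzero_entries n v) > 0)"
  proof (cases "v (Suc n) = 0 \<or> v (Suc n) = 1 \<or> v (Suc n) = -1")
    case True
    then show ?thesis
      unfolding alt_def nonzero_entries_Suc entries_Suc
      by (elim disjE) (cases "nonzero_entries n v = []";
          simp add: successively_append_iff sgn_if cong: conj_cong; linarith?)+
  next
    case False
    then show ?thesis
      unfolding alt_def entries_Suc by auto
  qed
  have prefix: "(\<forall>k\<le>Suc n. sum v {1..k} \<in> {0, 1}) \<longleftrightarrow>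
      (\<forall>k\<le>n. sum v {1..k} \<in> {0, 1}) \<and> sum v {1..n} + v (Suc n) \<in> {0, 1}"
    by (auto simp: le_Suc_eq)
  show ?case
  \<comment> \<open>If \<open>alt n\<close> holds, the known state gives the sum up to
    \<open>n\<close>, and the two conditions on the next entry agree. Otherwise both sides already
    fail on the prefix.\<close>
  proof (cases "alt n")
    case True
    with Suc.IH show ?thesis
      unfolding prefix alt_Suc nonzero_entries_Suc by auto
  next
    case False
    with Suc.IH show ?thesis
      unfolding prefix alt_Suc by blast
  qed
qed

text \<open>Of the three states in the previous lemma, a total of 1 leaves exactly the one whose
  last nonzero entry is 1.\<close>

lemma alternating_line_iff_partial_sums:
  "(\<forall>i\<in>{1..n}. v i \<in> {0, 1, -1}) \<and> alternating_line n v \<longleftrightarrow>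
     (\<forall>k\<le>n. sum v {1..k} \<in> {0, 1}) \<and> sum v {1..n} = 1"
  using partial_sums_iff_alternating[of n v]
  unfolding alternating_line_def Let_def by auto

lemma is_ASM_iff_partial_sums:
  fixes X :: "'n::{finite,linorder} square_matrix"
  shows "is_ASM X \<longleftrightarrow>
    (\<forall>i\<in>{1..CARD('n)}. (\<forall>k\<le>CARD('n). (\<Sum>j=1..k. entry X i j) \<in> {0, 1}) \<and>
        (\<Sum>j=1..CARD('n). entry X i j) = 1) \<and>
    (\<forall>j\<in>{1..CARD('n)}. (\<forall>k\<le>CARD('n). (\<Sum>i=1..k. entry X i j) \<in> {0, 1}) \<and>
        (\<Sum>i=1..CARD('n). entry X i j) = 1)"
  unfolding is_ASM_def alternating_line_iff_partial_sums[symmetric] by blast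

lemma entry_linear [simp]:
  "entry (X + Y) i j = entry X i j + entry Y i j"
  "entry (c *\<^sub>R X) i j = c * entry X i j"
  by (simp_all add: entry_def)

text \<open>With \<open>{0, 1}\<close> relaxed to \<open>{0..1}\<close> the conditions are linear
  inequalities and equations, so they define a convex set containing every ASM. They are the
  information about \<open>P_ASM\<close> on which the rounding relies.\<close>

lemma P_ASM_partial_sums:
  fixes X :: "'n::{finite,linorder} square_matrix"
  assumes "X \<in> P_ASM"
  shows "\<forall>i\<in>{1..CARD('n)}.
    (\<forall>k\<le>CARD('n). (\<Sum>j=1..k. entry X i j) \<in> {0..1} \<and> (\<Sum>j=1..k. entry X j i) \<in> {0..1}) \<and>
    (\<Sum>j=1..CARD('n). entry X i j) = 1 \<and> (\<Sum>j=1..CARD('n). entry X j i) = 1"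
    (is "?P X")
proof -
  have "convex hull {X. is_ASM X} \<subseteq> {X. ?P X}"
  proof (rule hull_minimal)
    have "{0, 1 :: real} \<subseteq> {0..1}"
      by auto
    then show "{X. is_ASM X} \<subseteq> {X. ?P X}"
      unfolding is_ASM_iff_partial_sums by blast
    show "convex {X. ?P X}"
    proof (rule convexI)
      fix X Y :: "'n square_matrix" and u v :: real
      assume X: "X \<in> {X. ?P X}" and Y: "Y \<in> {X. ?P X}" and uv: "0 \<le> u" "0 \<le> v" "u + v = 1"
      have mix: "u * a + v * b \<in> {0..1}" if "a \<in> {0..1}" "b \<in> {0..1}" for a b
        using convexD[OF convex_real_interval(5) that uv] by simp
      \<comment> \<open>The index functions \<open>f\<close> and \<open>g\<close> let one equation
        serve both row and column sums.\<close>
      have sums: "(\<Sum>j=1..k. entry (u *\<^sub>R X + v *\<^sub>R Y) (f j) (g j)) =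
          u * (\<Sum>j=1..k. entry X (f j) (g j)) + v * (\<Sum>j=1..k. entry Y (f j) (g j))" for k f g
        by (simp add: sum.distrib sum_distrib_left)
      show "u *\<^sub>R X + v *\<^sub>R Y \<in> {X. ?P X}"
        unfolding mem_Collect_eq sums
      proof (intro ballI conjI allI impI)
        fix i k assume i: "i \<in> {1..CARD('n)}"
        note X = X[unfolded mem_Collect_eq, rule_format, OF i]
        note Y = Y[unfolded mem_Collect_eq, rule_format, OF i]
        show "u * (\<Sum>j=1..CARD('n). entry X i j) + v * (\<Sum>j=1..CARD('n). entry Y i j) = 1"
          "u * (\<Sum>j=1..CARD('n). entry X j i) + v * (\<Sum>j=1..CARD('n). entry Y j i) = 1"
          using X Y uv(3) by simp_all
        assume "k \<le> CARD('n)"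
        with X Y show "u * (\<Sum>j=1..k. entry X i j) + v * (\<Sum>j=1..k. entry Y i j) \<in> {0..1}"
          "u * (\<Sum>j=1..k. entry X j i) + v * (\<Sum>j=1..k. entry Y j i) \<in> {0..1}"
          by (blast intro: mix)+
      qed
    qed
  qed
  with assms show ?thesis
    unfolding P_ASM_def by blast
qed

lemma convex_P_DAS: "convex P_DAS"
proof (rule convexI)
  fix X Y :: "'n::{finite,linorder} square_matrix" and u v :: real
  assume "X \<in> P_DAS" "Y \<in> P_DAS"
  then show "u *\<^sub>R X + v *\<^sub>R Y \<in> P_DAS"
    unfolding P_DAS_def mem_Collect_eq entry_linear by metis
qed

section \<open>Positions of indices, and finiteness of the set of ASMs\<close>

definition position :: "'n::{finite,linorder} \<Rightarrow> nat" where
  "position = inv_into {1..CARD('n)} index"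

lemma position_in_range: "position (i :: 'n::{finite,linorder}) \<in> {1..CARD('n)}"
  unfolding position_def using bij_betw_index by (metis UNIV_I bij_betw_def inv_into_into)

lemma index_position [simp]: "index (position i) = i"
  unfolding position_def using bij_betw_index by (metis UNIV_I bij_betw_def f_inv_into_f)

lemma position_index [simp]:
  "k \<in> {1..CARD('n)} \<Longrightarrow> position (index k :: 'n::{finite,linorder}) = k"
  unfolding position_def using bij_betw_index by (metis bij_betw_def inv_into_f_f)

definition matrix_of :: "(nat \<Rightarrow> nat \<Rightarrow> real) \<Rightarrow> 'n::{finite,linorder} square_matrix" where
  "matrix_of f = (\<chi> i j. f (position i) (position j))"

lemma entry_matrix_of [simp]:
  assumes "i \<in> {1..CARD('n)}" "j \<in> {1..CARD('n)}"
  shows "entry (matrix_of f :: 'n::{finite,linorder} square_matrix) i j = f i j"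
  using assms by (simp add: entry_def matrix_of_def)

lemma nth_nth_eq_entry: "X $ i $ j = entry X (position i) (position j)"
  by (simp add: entry_def)

text \<open>There are three possible values for each entry. Finiteness is inherited by the DASASMs
  and makes their convex hull closed.\<close>

lemma finite_ASM: "finite {X :: 'n::{finite,linorder} square_matrix. is_ASM X}"
proof (rule finite_subset)
  let ?F = "PiE (UNIV :: ('n \<times> 'n) set) (\<lambda>_. {0, 1, -1 :: real})"
  show "finite ((\<lambda>f. \<chi> i j. f (i, j)) ` ?F)"
    by (intro finite_imageI finite_PiE) auto
  show "{X :: 'n square_matrix. is_ASM X} \<subseteq> (\<lambda>f. \<chi> i j. f (i, j)) ` ?F"
  proof
    fix X :: "'n square_matrix"
    assume "X \<in> {X. is_ASM X}"
    then have "X $ i $ j \<in> {0, 1, -1}" for i j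
      using position_in_range unfolding nth_nth_eq_entry is_ASM_def by blast
    then have "(\<lambda>(i, j). X $ i $ j) \<in> ?F"
      by auto
    moreover have "X = (\<chi> i j. (\<lambda>(i, j). X $ i $ j) (i, j))"
      by (simp add: vec_eq_iff)
    ultimately show "X \<in> (\<lambda>f. \<chi> i j. f (i, j)) ` ?F"
      by (intro image_eqI) (simp_all add: case_prod_beta)
  qed
qed

section \<open>Corner sums, their symmetries and their inversion\<close>

definition corner_sum :: "(nat \<Rightarrow> nat \<Rightarrow> real) \<Rightarrow> nat \<Rightarrow> nat \<Rightarrow> real" where
  "corner_sum x k l = (\<Sum>i=1..k. \<Sum>j=1..l. x i j)"

lemma corner_sum_0 [simp]: "corner_sum x 0 l = 0" "corner_sum x k 0 = 0"
  by (simp_all add: corner_sum_def)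

lemma corner_sum_Suc_left: "corner_sum x (Suc k) l = corner_sum x k l + (\<Sum>j=1..l. x (Suc k) j)"
  by (simp add: corner_sum_def)

lemma corner_sum_Suc_right: "corner_sum x k (Suc l) = corner_sum x k l + (\<Sum>i=1..k. x i (Suc l))"
  by (simp add: corner_sum_def sum.distrib)

lemma corner_sum_diagonal_symmetric:
  assumes "\<And>i j. i \<in> {1..n} \<Longrightarrow> j \<in> {1..n} \<Longrightarrow> x i j = x j i" "k \<le> n" "l \<le> n"
  shows "corner_sum x k l = corner_sum x l k"
  unfolding corner_sum_def
  by (subst sum.swap) (use assms in \<open>auto intro!: sum.cong\<close>)

text \<open>The reflection carries the top left \<open>k\<close> by \<open>l\<close> block to the
  bottom right block with \<open>l\<close> rows and \<open>k\<close> columns. As all lines sum to 1,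
  the latter has sum \<open>l\<close> minus (\<open>n - k\<close> minus the complementary corner
  sum). The correction is an integer, possibly negative, so that it can later be moved out of a
  floor.\<close>

lemma corner_sum_antidiagonal_symmetric:
  assumes sym: "\<And>i j. i \<in> {1..n} \<Longrightarrow> j \<in> {1..n} \<Longrightarrow> x i j = x (n + 1 - j) (n + 1 - i)"
    and rows: "\<And>i. i \<in> {1..n} \<Longrightarrow> (\<Sum>j=1..n. x i j) = 1"
    and cols: "\<And>j. j \<in> {1..n} \<Longrightarrow> (\<Sum>i=1..n. x i j) = 1"
    and "k \<le> n" "l \<le> n"
  shows "corner_sum x k l = corner_sum x (n - l) (n - k) + of_int (int k + int l - int n)"
proof -
  \<comment> \<open>The first \<open>l\<close> entries of row \<open>i\<close> are the last
    \<open>l\<close> entries of column \<open>n + 1 - i\<close>, whose total is 1.\<close>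
  have line: "(\<Sum>j=1..l. x i j) = 1 - (\<Sum>j=1..n - l. x j (n + 1 - i))"
    if "i \<in> {1..n}" "l \<le> n" for i l
    using \<open>l \<le> n\<close>
  proof (induction l)
    case 0
    have "n + 1 - i \<in> {1..n}" using that(1) by auto
    from cols[OF this] show ?case by simp
  next
    case (Suc l)
    then have "n - l = Suc (n - Suc l)" by simp
    with Suc sym[of i "Suc l"] that(1) show ?case by auto
  qed
  \<comment> \<open>This serves the base case \<open>k = 0\<close>: there the reflected corner has
    all \<open>n\<close> columns, and its sum \<open>n - l\<close> cancels the correction.\<close>
  have full: "corner_sum x k' n = k'" if "k' \<le> n" for k'
    unfolding corner_sum_def using rows that by simp
  show ?thesis
    using \<open>k \<le> n\<close>
  proof (induction k)
    case 0
    then show ?case using full[of "n - l"] \<open>l \<le> n\<close> by (simp add: of_nat_diff)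
  next
    case (Suc k)
    then have "n - k = Suc (n - Suc k)" by simp
    with Suc line[of "Suc k" l] \<open>l \<le> n\<close> show ?case
      by (simp add: corner_sum_Suc_left corner_sum_Suc_right)
  qed
qed

text \<open>The inverse of forming corner sums. The subtractions truncate only at index 0, which is
  not a matrix index.\<close>

definition mixed_difference :: "(nat \<Rightarrow> nat \<Rightarrow> real) \<Rightarrow> nat \<Rightarrow> nat \<Rightarrow> real" where
  "mixed_difference F i j = F i j - F (i - 1) j - F i (j - 1) + F (i - 1) (j - 1)"

lemma mixed_difference_corner_sum:
  assumes "i \<ge> 1" "j \<ge> 1"
  shows "mixed_difference (corner_sum x) i j = x i j"
proof -
  obtain i' j' where "i = Suc i'" "j = Suc j'"
    using assms by (cases i; cases j) auto
  then show ?thesis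
    by (simp add: mixed_difference_def corner_sum_Suc_left)
qed

text \<open>Telescoping in one direction. The boundary terms are kept because shifted floors need
  not vanish at index 0; there they have the constant value floor of \<open>t\<close>, so that the
  terms cancel in the application.\<close>

lemma sum_mixed_difference:
  "(\<Sum>j=1..l. mixed_difference F i j) = F i l - F (i - 1) l - (F i 0 - F (i - 1) 0)"
  "(\<Sum>i=1..k. mixed_difference F i j) = F k j - F k (j - 1) - (F 0 j - F 0 (j - 1))"
  by (induction l) (simp_all add: mixed_difference_def, induction k, simp_all)

section \<open>Rounding the corner sums with a common shift\<close>

lemma floor_diff_in_01:
  fixes a b t :: real
  assumes "b - a \<in> {0..1}"
  shows "real_of_int \<lfloor>b + t\<rfloor> - real_of_int \<lfloor>a + t\<rfloor> \<in> {0, 1}"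
proof -
  \<comment> \<open>The floor is monotone, and \<open>b + t\<close> lies between
    \<open>a + t\<close> and \<open>a + t + 1\<close>.\<close>
  have "\<lfloor>a + t\<rfloor> \<le> \<lfloor>b + t\<rfloor>" "\<lfloor>b + t\<rfloor> \<le> \<lfloor>a + t + 1\<rfloor>"
    using assms by (simp_all only: atLeastAtMost_iff) (intro floor_mono; linarith)+
  then have "\<lfloor>b + t\<rfloor> = \<lfloor>a + t\<rfloor> \<or> \<lfloor>b + t\<rfloor> = \<lfloor>a + t\<rfloor> + 1"
    by linarith
  then show ?thesis
    by auto
qed

lemma floor_add_of_int_left: "\<lfloor>a + of_int m + t\<rfloor> = \<lfloor>a + t\<rfloor> + m"
  by (metis add.assoc add.commute floor_add_int)

text \<open>The same \<open>t\<close> at every corner is what lets comparisons between two corner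
  sums survive.\<close>

definition rounding :: "'n::{finite,linorder} square_matrix \<Rightarrow> real \<Rightarrow> 'n square_matrix" where
  "rounding X t = matrix_of (mixed_difference (\<lambda>k l. of_int \<lfloor>corner_sum (entry X) k l + t\<rfloor>))"

text \<open>A partial line sum of the rounding is a difference of two floors, and the corresponding
  difference without floors is a partial line sum of \<open>X\<close>, which lies in
  \<open>{0..1}\<close>. For a full line that difference is exactly 1, and floors keep integer
  differences.\<close>

lemma is_ASM_rounding:
  fixes X :: "'n::{finite,linorder} square_matrix"
  assumes "X \<in> P_ASM"
  shows "is_ASM (rounding X t)"
proof -
  let ?n = "CARD('n)"
  define F where "F k l = real_of_int \<lfloor>corner_sum (entry X) k l + t\<rfloor>" for k l
  have rounding: "entry (rounding X t) i j = mixed_difference F i j"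
    if "i \<in> {1..?n}" "j \<in> {1..?n}" for i j
    using that by (simp add: rounding_def F_def[abs_def])
  note X = P_ASM_partial_sums[OF assms, rule_format]
  have left: "corner_sum (entry X) i k - corner_sum (entry X) (i - 1) k = (\<Sum>j=1..k. entry X i j)"
    and right: "corner_sum (entry X) k i - corner_sum (entry X) k (i - 1) = (\<Sum>j=1..k. entry X j i)"
    if "i \<in> {1..?n}" for i k
    using that by (cases i; simp add: corner_sum_Suc_left corner_sum_Suc_right)+
  have rows: "(\<Sum>j=1..k. entry (rounding X t) i j) = F i k - F (i - 1) k"
    and cols: "(\<Sum>j=1..k. entry (rounding X t) j i) = F k i - F k (i - 1)"
    if "i \<in> {1..?n}" "k \<le> ?n" for i k
  proof -
    have "(\<Sum>j=1..k. entry (rounding X t) i j) = (\<Sum>j=1..k. mixed_difference F i j)"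
      using that by (intro sum.cong) (auto simp: rounding)
    then show "(\<Sum>j=1..k. entry (rounding X t) i j) = F i k - F (i - 1) k"
      by (simp add: sum_mixed_difference[unfolded One_nat_def] F_def)
    have "(\<Sum>j=1..k. entry (rounding X t) j i) = (\<Sum>j=1..k. mixed_difference F j i)"
      using that by (intro sum.cong) (auto simp: rounding)
    then show "(\<Sum>j=1..k. entry (rounding X t) j i) = F k i - F k (i - 1)"
      by (simp add: sum_mixed_difference[unfolded One_nat_def] F_def)
  qed
  have "F i k - F (i - 1) k \<in> {0, 1}" "F k i - F k (i - 1) \<in> {0, 1}"
    if "i \<in> {1..?n}" "k \<le> ?n" for i k
    unfolding F_def using that X[of i] left[of i k] right[of i k]
    by (auto simp del: insert_iff intro!: floor_diff_in_01)
  moreover have "F i ?n - F (i - 1) ?n = 1" "F ?n i - F ?n (i - 1) = 1" if "i \<in> {1..?n}" for i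
  proof -
    have "corner_sum (entry X) i ?n = corner_sum (entry X) (i - 1) ?n + of_int 1"
      "corner_sum (entry X) ?n i = corner_sum (entry X) ?n (i - 1) + of_int 1"
      using X[of i] left[of i ?n] right[of i ?n] that by auto
    then show "F i ?n - F (i - 1) ?n = 1" "F ?n i - F ?n (i - 1) = 1"
      unfolding F_def by (simp_all only: floor_add_of_int_left)
  qed
  ultimately show ?thesis
    unfolding is_ASM_iff_partial_sums
    by (intro ballI conjI allI impI) (simp_all only: rows cols order_refl)
qed

text \<open>Both symmetries equate two corner sums up to an integer, so they hold for the floors as
  well; taking mixed differences brings them back to the entries.\<close>

lemma rounding_in_P_DAS:
  fixes X :: "'n::{finite,linorder} square_matrix"
  assumes "X \<in> P_ASM" "X \<in> P_DAS"
  shows "rounding X t \<in> P_DAS"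
proof -
  let ?n = "CARD('n)"
  define F where "F k l = real_of_int \<lfloor>corner_sum (entry X) k l + t\<rfloor>" for k l
  have rounding: "entry (rounding X t) i j = mixed_difference F i j"
    if "i \<in> {1..?n}" "j \<in> {1..?n}" for i j
    using that by (simp add: rounding_def F_def[abs_def])
  note X = P_ASM_partial_sums[OF assms(1), rule_format]
  have sym: "entry X i j = entry X j i" "entry X i j = entry X (?n + 1 - j) (?n + 1 - i)"
    if "i \<in> {1..?n}" "j \<in> {1..?n}" for i j
  proof -
    have "entry X i j = entry X j i \<and> entry X j i = entry X (?n + 1 - j) (?n + 1 - i)"
      using assms(2) that unfolding P_DAS_def by blast
    then show "entry X i j = entry X j i" "entry X i j = entry X (?n + 1 - j) (?n + 1 - i)"
      by (blast, metis)
  qed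
  have diag: "F k l = F l k" if "k \<le> ?n" "l \<le> ?n" for k l
    unfolding F_def using corner_sum_diagonal_symmetric[of ?n "entry X", OF sym(1) that] by simp
  have anti: "F k l = F (?n - l) (?n - k) + of_int (int k + int l - int ?n)"
    if "k \<le> ?n" "l \<le> ?n" for k l
  proof -
    have "corner_sum (entry X) k l =
        corner_sum (entry X) (?n - l) (?n - k) + of_int (int k + int l - int ?n)"
      using that X by (intro corner_sum_antidiagonal_symmetric sym(2)) blast+
    then show ?thesis
      unfolding F_def by (simp only: floor_add_of_int_left of_int_add)
  qed
  have mixed: "mixed_difference F i j = mixed_difference F j i"
    "mixed_difference F i j = mixed_difference F (?n + 1 - j) (?n + 1 - i)"
    if ij: "i \<in> {1..?n}" "j \<in> {1..?n}" for i j
  proof -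
    show "mixed_difference F i j = mixed_difference F j i"
    proof -
      have "i \<le> ?n" "i - 1 \<le> ?n" "j \<le> ?n" "j - 1 \<le> ?n"
        using ij by auto
      then show ?thesis
        unfolding mixed_difference_def
        using diag[of i j] diag[of "i - 1" j] diag[of i "j - 1"] diag[of "i - 1" "j - 1"]
        by linarith
    qed
    \<comment> \<open>Since \<open>n + 1 - i\<close> is \<open>n - i'\<close> and its predecessor is
      \<open>n - Suc i'\<close>, the reflection matches the four corners of the cell
      \<open>(i, j)\<close> with those of the reflected cell, preserving their signs. The
      corrections \<open>k + l - n\<close> are a function of \<open>k\<close> plus a function of
      \<open>l\<close>, so the mixed difference cancels them.\<close>
    obtain i' j' where ij': "i = Suc i'" "j = Suc j'" "i' < ?n" "j' < ?n"
      using ij by (cases i; cases j) auto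
    have "F (Suc i') (Suc j') = F (?n - Suc j') (?n - Suc i') + (real i' + real j' + 2 - ?n)"
      "F i' (Suc j') = F (?n - Suc j') (?n - i') + (real i' + real j' + 1 - ?n)"
      "F (Suc i') j' = F (?n - j') (?n - Suc i') + (real i' + real j' + 1 - ?n)"
      "F i' j' = F (?n - j') (?n - i') + (real i' + real j' - ?n)"
      using ij'(3,4) by (subst anti; simp)+
    then show "mixed_difference F i j = mixed_difference F (?n + 1 - j) (?n + 1 - i)"
      by (simp add: mixed_difference_def ij')
  qed
  show ?thesis
    unfolding P_DAS_def mem_Collect_eq
  proof (intro ballI conjI)
    fix i j assume ij: "i \<in> {1..?n}" "j \<in> {1..?n}"
    then have ij': "?n + 1 - i \<in> {1..?n}" "?n + 1 - j \<in> {1..?n}"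
      by auto
    show "entry (rounding X t) i j = entry (rounding X t) j i"
      using mixed(1)[OF ij] unfolding rounding[OF ij] rounding[OF ij(2,1)] .
    then show "entry (rounding X t) j i = entry (rounding X t) (?n + 1 - j) (?n + 1 - i)"
      using mixed(2)[OF ij] unfolding rounding[OF ij] rounding[OF ij'(2,1)] by simp
  qed
qed

text \<open>An entry of the rounding is linear in the floored corner sums, so each of the four
  floors can be replaced by its mean; the mixed difference of the true corner sums is the entry of
  \<open>X\<close>.\<close>

lemma has_integral_rounding: "(rounding X has_integral X) {0..1}"
proof (rule has_integral_matrixI)
  fix i j :: 'a
  have "((\<lambda>t. mixed_difference (\<lambda>k l. of_int \<lfloor>corner_sum (entry X) k l + t\<rfloor>) (position i) (position j))
      has_integral mixed_difference (corner_sum (entry X)) (position i) (position j)) {0..1}"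
    unfolding mixed_difference_def
    by (intro has_integral_add has_integral_diff has_integral_floor_shift)
  then show "((\<lambda>t. rounding X t $ i $ j) has_integral X $ i $ j) {0..1}"
    using position_in_range[of i] position_in_range[of j]
    by (simp add: mixed_difference_corner_sum rounding_def matrix_of_def nth_nth_eq_entry[of X])
qed

theorem theorem8p3:
  shows "(P_DASASM :: 'n::{finite,linorder} square_matrix set) = P_ASM \<inter> P_DAS"
proof
  show "(P_DASASM :: 'n square_matrix set) \<subseteq> P_ASM \<inter> P_DAS"
    unfolding P_DASASM_def
  proof (rule hull_minimal)
    show "{X. is_DASASM X} \<subseteq> (P_ASM :: 'n square_matrix set) \<inter> P_DAS"
      by (auto simp: is_DASASM_def P_ASM_def hull_inc)
    show "convex ((P_ASM :: 'n square_matrix set) \<inter> P_DAS)"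
      by (simp add: convex_Int convex_P_DAS P_ASM_def)
  qed
  show "P_ASM \<inter> P_DAS \<subseteq> (P_DASASM :: 'n square_matrix set)"
  proof
    fix X :: "'n square_matrix"
    assume "X \<in> P_ASM \<inter> P_DAS"
    then have "\<And>t. rounding X t \<in> {X. is_DASASM X}"
      by (simp add: is_DASASM_def is_ASM_rounding rounding_in_P_DAS)
    moreover have "finite {X :: 'n square_matrix. is_DASASM X}"
      by (rule finite_subset[OF _ finite_ASM]) (auto simp: is_DASASM_def)
    ultimately show "X \<in> P_DASASM"
      unfolding P_DASASM_def
      by (intro has_integral_in_convex_hull[OF _ _ has_integral_rounding])
  qed
qed

end
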